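(* The VCG mechanism for the shipper markets, [VCG/Shipper] (defined in the context), is truthful and efficient. That is: (truthful) for every shipper $b\in\mathcal B_j$, every bid vector $\mathbf s_b\in\mathbb R^{\tilde{\mathcal T}}$ and every profile $\mathbf s_{-b}$ of bids of the other shippers, $$u_b(-\mathbf c_b,\mathbf s_{-b})\ge u_b(\mathbf s_b,\mathbf s_{-b}),$$ where $\mathbf c_b=(c^b_t)_{t\in\tilde{\mathcal T}}$ is the true perceived cost vector of $b$; (efficient) when all shippers bid truthfully ($\mathbf s_b=-\mathbf c_b$ for all $b\in\mathcal B_j$), the resulting assignment maximizes the social surplus, i.e. minimizes $\sum_{b\in\mathcal B_j}\sum_{t\in\tilde{\mathcal T}}n^b_tc^b_t$ over all feasible assignments.
   Context: Fix a task category $j$, a finite set $\mathcal B_j$ of shippers with $|\mathcal B_j|=N^S_j$, and a finite set of options $\tilde{\mathcal T}=\{0,1,\dots,T\}$ (time windows together with the opt-out $0$). Numbers of permits $y_{j,t}\in\mathbb Z_{\ge0}$, $t\in\tilde{\mathcal T}$, are given with $\sum_{t\in\tilde{\mathcal T}}y_{j,t}=N^S_j$. Each shipper $b$ has privately known perceived costs $c^b_t\in\mathbb R$, $t\in\tilde{\mathcal T}$. A feasible assignment is $\mathbf n=(n^b_t)$ with $n^b_t\in\{0,1\}$, $\sum_{t\in\tilde{\mathcal T}}n^b_t=1$ for all $b\in\mathcal B_j$, and $\sum_{b\in\mathcal B_j}n^b_t=y_{j,t}$ for all $t\in\tilde{\mathcal T}$. Mechanism [VCG/Shipper]. (1) Each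 shipper $b\in\mathcal B_j$ submits a bid $\mathbf s_b=(s^b_t)_{t\in\tilde{\mathcal T}}$ of real numbers. (2) The platform chooses a feasible assignment $\mathbf n^\star(\mathbf s)$ maximizing $\sum_{b\in\mathcal B_j}\sum_{t\in\tilde{\mathcal T}}n^b_ts^b_t$ over feasible assignments (with any fixed selection rule if there are several maximizers). (3) Shipper $b$ pays $$p_b(\mathbf s_b,\mathbf s_{-b})=\max_{\mathbf n_{-b}}z^S_{j,-b}(\mathbf n_{-b}|\mathbf s_{-b},\mathbf y)-\sum_{b'\in\mathcal B_j\setminus\{b\}}\sum_{t\in\tilde{\mathcal T}}n^{b'\star}_t(\mathbf s)\,s^{b'}_t,$$ where the first term is the maximum surplus of the other shippers achieved without the participation of $b$: $z^S_{j,-b}(\mathbf n_{-b}|\mathbf s_{-b},\mathbf y)=\sum_{b'\ne b}\sum_{t\in\tilde{\mathcal T}}n^{b'}_ts^{b'}_t$, maximized over $n^{b'}_t\in\{0,1\}$ ($b'\in\mathcal B_j\setminus\{b\}$) with $\sum_{t\in\tilde{\mathcal T}}n^{b'}_t=1$ and $\sum_{b'\ne b}n^{b'}_t\le y_{j,t}$ for all $t\in\tilde{\mathcal T}$. The utility of shipper $b$ is $u_b(\mathbf s_b,\mathbf s_{-b})=-\sum_{t\in\tilde{\mathcal T}}n^{b\star}_t(\mathbf s_b,\mathbf s_{-b})\,c^b_t-p_b(\mathbf s_b,\mathbf s_{-b})$. The subscript $-b$ denotes all shippers in $\mathcal B_j$ other than $b$. *)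

theory Defs
  imports Complex_Main
begin

text \<open>
  Shippers are the elements of a finite set \<open>B\<close>, options are the numbers in \<open>{0..T}\<close> with
  opt-out \<open>0\<close>. Assignments, bids and costs are total functions; only their values on
  \<open>B\<close> and \<open>{0..T}\<close> are constrained and only these enter the sums below.
\<close>

type_synonym 'b assignment = "'b \<Rightarrow> nat \<Rightarrow> nat"
type_synonym 'b profile = "'b \<Rightarrow> nat \<Rightarrow> real"

definition assigns_one :: "'b set \<Rightarrow> nat \<Rightarrow> 'b assignment \<Rightarrow> bool" where
  "assigns_one B T n \<longleftrightarrow>
     (\<forall>b\<in>B. (\<forall>t\<in>{0..T}. n b t \<in> {0, 1}) \<and> (\<Sum>t\<in>{0..T}. n b t) = 1)"

definition feasible :: "'b set \<Rightarrow> nat \<Rightarrow> (nat \<Rightarrow> nat) \<Rightarrow> 'b assignment \<Rightarrow> bool" where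
  "feasible B T y n \<longleftrightarrow> assigns_one B T n \<and> (\<forall>t\<in>{0..T}. (\<Sum>b\<in>B. n b t) = y t)"

definition feasible_without ::
    "'b set \<Rightarrow> nat \<Rightarrow> (nat \<Rightarrow> nat) \<Rightarrow> 'b \<Rightarrow> 'b assignment \<Rightarrow> bool" where
  "feasible_without B T y b n \<longleftrightarrow>
     assigns_one (B - {b}) T n \<and> (\<forall>t\<in>{0..T}. (\<Sum>b'\<in>B - {b}. n b' t) \<le> y t)"

definition surplus :: "'b set \<Rightarrow> nat \<Rightarrow> 'b profile \<Rightarrow> 'b assignment \<Rightarrow> real" where
  "surplus B T s n = (\<Sum>b\<in>B. \<Sum>t\<in>{0..T}. real (n b t) * s b t)"

definition social_cost :: "'b set \<Rightarrow> nat \<Rightarrow> 'b profile \<Rightarrow> 'b assignment \<Rightarrow> real" where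
  "social_cost B T c n = (\<Sum>b\<in>B. \<Sum>t\<in>{0..T}. real (n b t) * c b t)"

text \<open>
  The platform's choice \<open>nstar\<close> is an arbitrary function of the bid profile that returns a
  maximizer, which covers every rule for selecting among several maximizers.
\<close>

definition vcg_allocation ::
    "'b set \<Rightarrow> nat \<Rightarrow> (nat \<Rightarrow> nat) \<Rightarrow> ('b profile \<Rightarrow> 'b assignment) \<Rightarrow> bool" where
  "vcg_allocation B T y nstar \<longleftrightarrow> (\<forall>s. is_arg_max (surplus B T s) (feasible B T y) (nstar s))"

text \<open>
  The set under \<open>Max\<close> is finite for finite \<open>B\<close>, although the set of total functions \<open>n\<close> need
  not be: the surplus only depends on the 0/1 values of \<open>n\<close> on \<open>B - {b}\<close> and \<open>{0..T}\<close>.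
\<close>

definition payment ::
    "'b set \<Rightarrow> nat \<Rightarrow> (nat \<Rightarrow> nat) \<Rightarrow> ('b profile \<Rightarrow> 'b assignment) \<Rightarrow> 'b \<Rightarrow> 'b profile \<Rightarrow> real" where
  "payment B T y nstar b s =
     Max {surplus (B - {b}) T s n | n. feasible_without B T y b n}
     - (\<Sum>b'\<in>B - {b}. \<Sum>t\<in>{0..T}. real (nstar s b' t) * s b' t)"

definition utility ::
    "'b set \<Rightarrow> nat \<Rightarrow> (nat \<Rightarrow> nat) \<Rightarrow> ('b profile \<Rightarrow> 'b assignment) \<Rightarrow> 'b profile \<Rightarrow> 'b \<Rightarrow>
     'b profile \<Rightarrow> real" where
  "utility B T y nstar c b s =
     - (\<Sum>t\<in>{0..T}. real (nstar s b t) * c b t) - payment B T y nstar b s"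

end

theory Submission
  imports Defs
begin

text \<open>
  The payment charges shipper \<open>b\<close> the externality that it imposes on the others. Adding the
  others' reported surplus under the chosen assignment to the true value of \<open>b\<close> turns the
  utility of \<open>b\<close> into a surplus of the whole market, computed with the true valuation of \<open>b\<close>
  and the reports of the others, minus a term on which the bid of \<open>b\<close> has no influence
  (lemma \<open>utility_eq_surplus_minus_pivot\<close>). The bid of \<open>b\<close> therefore matters only through the
  assignment that it induces. With a truthful bid the platform maximizes exactly this surplus, so
  no other bid can lead to a better feasible assignment. This argument compares the
  assignments chosen for two profiles only through their feasibility and optimality, hence it holds
  for every rule for selecting among several maximizers.

  Efficiency is the case in which everyone is truthful: reported surplus is then the negative
  of social cost, so that maximizing one minimizes the other.
\<close>

lemma surplus_others_fun_upd:
  "surplus (B - {b}) T (s(b := v)) n = surplus (B - {b}) T s n"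
  unfolding surplus_def by (intro sum.cong) auto

lemma surplus_split:
  assumes "finite B" and "b \<in> B"
  shows "surplus B T s n = (\<Sum>t\<in>{0..T}. real (n b t) * s b t) + surplus (B - {b}) T s n"
  unfolding surplus_def by (rule sum.remove[OF assms])

lemma surplus_uminus: "surplus B T (\<lambda>b t. - c b t) n = - social_cost B T c n"
  by (simp add: surplus_def social_cost_def sum_negf)

lemma vcg_allocation_feasible:
  "vcg_allocation B T y nstar \<Longrightarrow> feasible B T y (nstar s)"
  by (simp add: vcg_allocation_def is_arg_max_def)

lemma vcg_allocation_maximal:
  "vcg_allocation B T y nstar \<Longrightarrow> feasible B T y n \<Longrightarrow> surplus B T s n \<le> surplus B T s (nstar s)"
  by (auto simp: vcg_allocation_def is_arg_max_linorder)

text \<open>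
  This is where the payment rule aligns the interest of \<open>b\<close> with that of the platform: the part of
  the payment that depends on the assignment is the surplus of the others, which together
  with the true value of \<open>b\<close> is the surplus of the whole market. The remaining maximum is the
  pivot term of the Clarke payment.
\<close>

lemma utility_eq_surplus_minus_pivot:
  assumes "finite B" and "b \<in> B"
  shows "utility B T y nstar c b (s(b := v)) =
           surplus B T (s(b := (\<lambda>t. - c b t))) (nstar (s(b := v)))
           - Max {surplus (B - {b}) T s n | n. feasible_without B T y b n}"
proof -
  have "payment B T y nstar b (s(b := v)) =
          Max {surplus (B - {b}) T s n | n. feasible_without B T y b n}
          - surplus (B - {b}) T s (nstar (s(b := v)))"
    by (simp only: payment_def surplus_def[symmetric] surplus_others_fun_upd)
  then show ?thesis
    by (simp add: utility_def surplus_split[OF assms] surplus_others_fun_upd sum_negf)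
qed

lemma vcg_truthful:
  assumes "finite B" and "b \<in> B" and vcg: "vcg_allocation B T y nstar"
  shows "utility B T y nstar c b (s(b := v))
           \<le> utility B T y nstar c b (s(b := (\<lambda>t. - c b t)))"
  using vcg_allocation_maximal[OF vcg vcg_allocation_feasible[OF vcg]]
  by (simp add: utility_eq_surplus_minus_pivot[OF assms(1,2)])

lemma vcg_efficient:
  assumes "vcg_allocation B T y nstar"
  shows "is_arg_min (social_cost B T c) (feasible B T y) (nstar (\<lambda>b t. - c b t))"
  using vcg_allocation_feasible[OF assms]
    vcg_allocation_maximal[OF assms, where s = "\<lambda>b t. - c b t"]
  by (auto simp: is_arg_min_linorder surplus_uminus)

theorem proposition6p1:
  fixes B :: "'b set" and T N :: nat and y :: "nat \<Rightarrow> nat"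
    and c :: "'b \<Rightarrow> nat \<Rightarrow> real"
    and nstar :: "('b \<Rightarrow> nat \<Rightarrow> real) \<Rightarrow> 'b \<Rightarrow> nat \<Rightarrow> nat"
  assumes "finite B" and "card B = N"
    and "(\<Sum>t\<in>{0..T}. y t) = N"
    and "vcg_allocation B T y nstar"
  shows "(\<forall>b\<in>B. \<forall>s_b :: nat \<Rightarrow> real. \<forall>s :: 'b \<Rightarrow> nat \<Rightarrow> real.
            utility B T y nstar c b (s(b := (\<lambda>t. - c b t)))
              \<ge> utility B T y nstar c b (s(b := s_b)))
       \<and> is_arg_min (social_cost B T c) (feasible B T y) (nstar (\<lambda>b t. - c b t))"
  using vcg_truthful[OF assms(1) _ assms(4)] vcg_efficient[OF assms(4)] by blast

end
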